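(* Let $G$ be an abelian group and let $(a_n)_{n\in\omega}$ be a non-trivial $T$-sequence in $G$ such that $\{a_n:n\in\omega\}$ generates $G$. Then the space of ends (binary corona) of the coarse space $(G,\mathcal{C}_{\tau(a_n)})$ is a singleton.
   Context: A sequence $(a_n)$ in an abelian group $G$ is a $T$-sequence if there is a Hausdorff group topology on $G$ in which $(a_n)\to0$; it is non-trivial if $a_n\neq0$ for infinitely many $n$. $\tau(a_n)$ is the strongest group topology on $G$ in which $(a_n)\to0$, and $\mathcal{C}_{\tau(a_n)}$ is the group ideal of precompact subsets of $(G,\tau(a_n))$; it defines the coarse structure with base $\{\{(x,y):x\in A+y\}:A\in\mathcal{C}_{\tau(a_n)}\}$. In a coarse space $(X,\mathcal{E})$, $E[x]=\{y:(x,y)\in E\}$, and a set is bounded if it is contained in some $E[x]$ (here: bounded sets are exactly the members of $\mathcal{C}_{\tau(a_n)}$). A function $f:X\to\{0,1\}$ is slowly oscillating if for every $E\in\mathcal{E}$ there is a bounded $B\subseteq X$ such that $f$ is constant on $E[x]$ for every $x\in X\setminus B$. Identify the Stone–Čech compactification $\beta X$ of discrete $X$ with the set of ultrafilters on $X$, let $X^\sharp=\{p\in\beta X: \text{every } P\in p \text{ is unbounded}\}$, and define $p\sim q$ iff $f^\beta(p)=f^\beta(q)$ for every slowly oscillating $f:X\to\{0,1\}$, where $f^\beta$ is the continuous extension of $f$ to $\beta X$. The space of ends is $X^\sharp/\sim$. *)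

theory Defs
  imports "HOL-Analysis.Analysis"
begin

definition add_subgroup :: "'a::ab_group_add set \<Rightarrow> bool" where
  "add_subgroup H \<longleftrightarrow> 0 \<in> H \<and> (\<forall>x\<in>H. \<forall>y\<in>H. x + y \<in> H) \<and> (\<forall>x\<in>H. - x \<in> H)"

definition generated_subgroup :: "'a::ab_group_add set \<Rightarrow> 'a set" where
  "generated_subgroup S = \<Inter>{H. add_subgroup H \<and> S \<subseteq> H}"

definition group_topology :: "'a::ab_group_add topology \<Rightarrow> bool" where
  "group_topology T \<longleftrightarrow> topspace T = UNIV
     \<and> continuous_map (prod_topology T T) T (\<lambda>(x, y). x + y)
     \<and> continuous_map T T uminus"

definition T_sequence :: "(nat \<Rightarrow> 'a::ab_group_add) \<Rightarrow> bool" where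
  "T_sequence a \<longleftrightarrow> (\<exists>T. group_topology T \<and> Hausdorff_space T \<and> limitin T a 0 sequentially)"

definition nontrivial_seq :: "(nat \<Rightarrow> 'a::ab_group_add) \<Rightarrow> bool" where
  "nontrivial_seq a \<longleftrightarrow> infinite {n. a n \<noteq> 0}"

definition tau :: "(nat \<Rightarrow> 'a::ab_group_add) \<Rightarrow> 'a topology" where
  "tau a = (THE T. group_topology T \<and> limitin T a 0 sequentially \<and>
      (\<forall>T'. group_topology T' \<and> limitin T' a 0 sequentially \<longrightarrow>
            (\<forall>U. openin T' U \<longrightarrow> openin T U)))"

definition precompact :: "'a::ab_group_add topology \<Rightarrow> 'a set \<Rightarrow> bool" where
  "precompact T A \<longleftrightarrow>
     (\<forall>U. openin T U \<and> 0 \<in> U \<longrightarrow> (\<exists>F. finite F \<and> A \<subseteq> (\<Union>x\<in>F. (\<lambda>u. x + u) ` U)))"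

definition coarse_entourages :: "'a::ab_group_add topology \<Rightarrow> ('a \<times> 'a) set set" where
  "coarse_entourages T =
     {E. \<exists>A. precompact T A \<and> E \<subseteq> {(x, y). x \<in> (\<lambda>u. u + y) ` A}}"

definition ball_of :: "('a \<times> 'a) set \<Rightarrow> 'a \<Rightarrow> 'a set" where
  "ball_of E x = {y. (x, y) \<in> E}"

definition coarse_bounded :: "'a::ab_group_add topology \<Rightarrow> 'a set \<Rightarrow> bool" where
  "coarse_bounded T B \<longleftrightarrow> (\<exists>E\<in>coarse_entourages T. \<exists>x. B \<subseteq> ball_of E x)"

text \<open>Functions X \<rightarrow> {0,1} are represented as bool-valued functions.\<close>
definition slowly_oscillating :: "'a::ab_group_add topology \<Rightarrow> ('a \<Rightarrow> bool) \<Rightarrow> bool" where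
  "slowly_oscillating T f \<longleftrightarrow>
     (\<forall>E\<in>coarse_entourages T. \<exists>B. coarse_bounded T B \<and>
        (\<forall>x. x \<notin> B \<longrightarrow> (\<forall>y\<in>ball_of E x. \<forall>z\<in>ball_of E x. f y = f z)))"

text \<open>Points of beta X: ultrafilters on X, as sets of subsets.\<close>
definition is_ultrafilter :: "'a set set \<Rightarrow> bool" where
  "is_ultrafilter p \<longleftrightarrow> UNIV \<in> p \<and> {} \<notin> p
     \<and> (\<forall>A B. A \<in> p \<and> A \<subseteq> B \<longrightarrow> B \<in> p)
     \<and> (\<forall>A B. A \<in> p \<and> B \<in> p \<longrightarrow> A \<inter> B \<in> p)
     \<and> (\<forall>A. A \<in> p \<or> - A \<in> p)"

text \<open>Continuous extension of f : X \<rightarrow> {0,1} to beta X: the value i with f^{-1}(i) \<in> p.\<close>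
definition beta_ext :: "('a \<Rightarrow> bool) \<Rightarrow> 'a set set \<Rightarrow> bool" where
  "beta_ext f p = (THE i. {x. f x = i} \<in> p)"

definition X_sharp :: "'a::ab_group_add topology \<Rightarrow> 'a set set set" where
  "X_sharp T = {p. is_ultrafilter p \<and> (\<forall>P\<in>p. \<not> coarse_bounded T P)}"

definition ends_rel :: "'a::ab_group_add topology \<Rightarrow> ('a set set \<times> 'a set set) set" where
  "ends_rel T = {(p, q). p \<in> X_sharp T \<and> q \<in> X_sharp T \<and>
      (\<forall>f. slowly_oscillating T f \<longrightarrow> beta_ext f p = beta_ext f q)}"

definition space_of_ends :: "'a::ab_group_add topology \<Rightarrow> 'a set set set set" where
  "space_of_ends T = X_sharp T // ends_rel T"

end

(* Let A = {0} \<union> {a_n} \<union> {-a_n}, and let kA be the k-fold sum of A (word_ball a k).  In tau(a_n)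
   the bounded sets are exactly the subsets of the sets kA: if a set P lies in no kA, then G
   being countable one can pick p_n \<in> P far away from the first n elements of G, and compactness
   of the partial sums yields indices m_i such that the tau-neighbourhood
   \<Union>_k A_{m_0} + ... + A_{m_(k-1)} of 0, where A_m is the m-th tail of A, has no finite set of
   translates covering all p_n.

   A slowly oscillating f therefore satisfies f(x + s) = f(x) for s \<in> A and x outside some kA.
   Given x, y outside kA, one walks x, x + a_i, x + a_i + a_j, ... and likewise from y, always using
   indices so large that both walks avoid the closed set kA.  The set of displacements z reachable
   this way has no isolated points, so by Baire it lies in no countable compact set; hence some z
   is so far away that x + z can be joined to y + z outside kA, and f(x) = f(y). *)
theory Submission
  imports Defs
begin

section \<open>Neighbourhoods of 0, and existence of the strongest group topology with a given null
  sequence\<close>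

section \<open>Group topologies\<close>

lemma group_topology_add_nhd:
  assumes "group_topology T" "openin T U" "0 \<in> U"
  obtains V where "openin T V" "0 \<in> V" "\<And>x y. x \<in> V \<Longrightarrow> y \<in> V \<Longrightarrow> x + y \<in> U"
proof -
  have "openin (prod_topology T T) {z \<in> topspace (prod_topology T T). (case z of (x, y) \<Rightarrow> x + y) \<in> U}"
    using assms unfolding group_topology_def by (intro openin_continuous_map_preimage) auto
  moreover have "(0, 0) \<in> {z \<in> topspace (prod_topology T T). (case z of (x, y) \<Rightarrow> x + y) \<in> U}"
    using assms by (auto simp: group_topology_def)
  ultimately obtain V W where VW: "openin T V" "openin T W" "0 \<in> V" "0 \<in> W"
      "V \<times> W \<subseteq> {z \<in> topspace (prod_topology T T). (case z of (x, y) \<Rightarrow> x + y) \<in> U}"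
    unfolding openin_prod_topology_alt by meson
  show ?thesis
    using VW by (intro that[of "V \<inter> W"]) auto
qed

lemma group_topology_continuous_translation:
  assumes "group_topology T"
  shows "continuous_map T T (\<lambda>x. c + x)"
proof -
  have "continuous_map T (prod_topology T T) (\<lambda>x. (c, x))"
    using assms by (auto simp: group_topology_def intro!: continuous_map_pairedI)
  then have "continuous_map T T ((\<lambda>(x, y). x + y) \<circ> (\<lambda>x. (c, x)))"
    using assms unfolding group_topology_def by (blast intro: continuous_map_compose)
  then show ?thesis
    by (simp add: comp_def)
qed

lemma group_topology_limit_uminus:
  assumes "group_topology T" "limitin T a 0 sequentially"
  shows "limitin T (\<lambda>n. - a n) 0 sequentially"
  using continuous_map_limit[of T T uminus a 0 sequentially] assms
  by (simp add: group_topology_def comp_def)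

text \<open>The translates \<open>c + a n\<close> tend to \<open>c\<close>, and the complement of
  \<open>K\<close> is open. This serves twice: to choose tails that miss finitely many points, and
  to take steps that stay outside a ball.\<close>

lemma eventually_translate_notin_closed:
  assumes "group_topology T" "limitin T a 0 sequentially" "closedin T K" "c \<notin> K"
  shows "\<forall>\<^sub>F n in sequentially. c + a n \<notin> K"
proof -
  have "limitin T (\<lambda>n. c + a n) c sequentially"
    using continuous_map_limit[OF group_topology_continuous_translation[OF assms(1), of c] assms(2)]
    by (simp add: comp_def)
  moreover have "openin T (- K)"
    using assms by (simp add: closedin_def group_topology_def Compl_eq_Diff_UNIV)
  ultimately show ?thesis
    using assms(4) by (force dest: limitinD)
qed

text \<open>The topology is the usual one: a set is open when around each of its points it contains
  a translate of a member of the base. Members of the base need not be open, so the last two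
  conclusions express only that they form a base of neighbourhoods of 0.\<close>

lemma group_topology_of_neighbourhood_base:
  fixes \<N> :: "'a::ab_group_add set set"
  assumes ne: "\<N> \<noteq> {}"
    and zero: "\<And>U. U \<in> \<N> \<Longrightarrow> 0 \<in> U"
    and inter: "\<And>U V. U \<in> \<N> \<Longrightarrow> V \<in> \<N> \<Longrightarrow> \<exists>W\<in>\<N>. W \<subseteq> U \<inter> V"
    and add: "\<And>U. U \<in> \<N> \<Longrightarrow> \<exists>V\<in>\<N>. \<forall>x\<in>V. \<forall>y\<in>V. x + y \<in> U"
    and uminus: "\<And>U. U \<in> \<N> \<Longrightarrow> \<exists>V\<in>\<N>. \<forall>x\<in>V. - x \<in> U"
  obtains T where "group_topology T"
    and "\<And>U. U \<in> \<N> \<Longrightarrow> \<exists>W. openin T W \<and> 0 \<in> W \<and> W \<subseteq> U"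
    and "\<And>W. openin T W \<Longrightarrow> 0 \<in> W \<Longrightarrow> \<exists>U\<in>\<N>. U \<subseteq> W"
proof -
  define op where "op = (\<lambda>W. \<forall>x\<in>W. \<exists>U\<in>\<N>. \<forall>u\<in>U. x + u \<in> W)"
  have "istopology op"
    unfolding istopology_def
  proof (intro conjI allI impI)
    fix S W assume S: "op S" and W: "op W"
    show "op (S \<inter> W)"
      unfolding op_def
    proof
      fix x assume x: "x \<in> S \<inter> W"
      obtain U where U: "U \<in> \<N>" "\<forall>u\<in>U. x + u \<in> S"
        using S x by (auto simp: op_def)
      obtain V where V: "V \<in> \<N>" "\<forall>u\<in>V. x + u \<in> W"
        using W x by (auto simp: op_def)
      obtain W' where "W' \<in> \<N>" "W' \<subseteq> U \<inter> V"
        using inter[OF U(1) V(1)] by auto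
      then show "\<exists>U\<in>\<N>. \<forall>u\<in>U. x + u \<in> S \<inter> W"
        using U V by (intro bexI[of _ W']) auto
    qed
  next
    fix \<K> assume "\<forall>K\<in>\<K>. op K"
    then show "op (\<Union>\<K>)"
      unfolding op_def by (metis Union_iff)
  qed
  define T where "T = topology op"
  have openT: "openin T W \<longleftrightarrow> op W" for W
    using \<open>istopology op\<close> by (simp add: T_def topology_inverse')
  have "op UNIV"
    using ne by (auto simp: op_def)
  then have top: "topspace T = UNIV"
    using openin_subset[of T UNIV] by (simp add: openT top.extremum_unique)
  \<comment> \<open>\<open>core c U\<close> is the interior of the translate of \<open>U\<close> by
    \<open>c\<close>. It supplies the open sets that \<open>openin_prod_topology_alt\<close>
    demands, since the translate itself may fail to be open.\<close>
  define core where "core = (\<lambda>c U. {x. \<exists>V\<in>\<N>. \<forall>v\<in>V. x + v \<in> (\<lambda>u. c + u) ` U})"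
  have core_open: "openin T (core c U)" for c U
    unfolding openT op_def
  proof
    fix x assume "x \<in> core c U"
    then obtain V where V: "V \<in> \<N>" "\<forall>v\<in>V. x + v \<in> (\<lambda>u. c + u) ` U"
      by (auto simp: core_def)
    then obtain W where W: "W \<in> \<N>" "\<forall>x\<in>W. \<forall>y\<in>W. x + y \<in> V"
      using add[OF V(1)] by auto
    have "x + w \<in> core c U" if "w \<in> W" for w
      using V W that unfolding core_def by (auto simp: add.assoc intro!: bexI[of _ W])
    then show "\<exists>W\<in>\<N>. \<forall>w\<in>W. x + w \<in> core c U"
      using W by blast
  qed
  have core_mem: "c \<in> core c U" if "U \<in> \<N>" for c U
    using that by (auto simp: core_def)
  have core_sub: "core c U \<subseteq> (\<lambda>u. c + u) ` U" for c U
    using zero by (force simp: core_def)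
  have "continuous_map (prod_topology T T) T (\<lambda>(x, y). x + y)"
    unfolding continuous_map_def
  proof (intro conjI allI impI)
    fix W assume W: "openin T W"
    show "openin (prod_topology T T) {z \<in> topspace (prod_topology T T). (case z of (x, y) \<Rightarrow> x + y) \<in> W}"
      unfolding openin_prod_topology_alt
    proof (intro allI impI)
      fix x y assume "(x, y) \<in> {z \<in> topspace (prod_topology T T). (case z of (x, y) \<Rightarrow> x + y) \<in> W}"
      then have "x + y \<in> W"
        by simp
      then obtain U where U: "U \<in> \<N>" "\<forall>u\<in>U. x + y + u \<in> W"
        using W by (auto simp: openT op_def)
      then obtain V where V: "V \<in> \<N>" "\<forall>x\<in>V. \<forall>y\<in>V. x + y \<in> U"
        using add[OF U(1)] by auto
      have "x' + y' \<in> W" if x': "x' \<in> core x V" and y': "y' \<in> core y V" for x' y'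
      proof -
        obtain u v where "x' = x + u" "y' = y + v" "u \<in> V" "v \<in> V"
          using core_sub x' y' by blast
        then show ?thesis
          using U V by (metis (no_types, lifting) add.assoc add.left_commute)
      qed
      then show "\<exists>U V. openin T U \<and> openin T V \<and> x \<in> U \<and> y \<in> V \<and>
          U \<times> V \<subseteq> {z \<in> topspace (prod_topology T T). (case z of (x, y) \<Rightarrow> x + y) \<in> W}"
        using core_open core_mem[OF V(1)] top
        by (intro exI[of _ "core x V"] exI[of _ "core y V"]) auto
    qed
  qed (simp add: top)
  moreover have "continuous_map T T uminus"
    unfolding continuous_map_def
  proof (intro conjI allI impI)
    fix W assume W: "openin T W"
    have "\<exists>V\<in>\<N>. \<forall>v\<in>V. - (x + v) \<in> W" if "- x \<in> W" for x
    proof -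
      have "\<exists>U\<in>\<N>. \<forall>u\<in>U. - x + u \<in> W"
        using W that unfolding openT op_def by (rule bspec)
      then obtain U where U: "U \<in> \<N>" "\<forall>u\<in>U. - x + u \<in> W"
        by blast
      then obtain V where "V \<in> \<N>" "\<forall>x\<in>V. - x \<in> U"
        using uminus[OF U(1)] by auto
      then show ?thesis
        using U by (intro bexI[of _ V]) (auto simp: algebra_simps)
    qed
    then show "openin T {x \<in> topspace T. - x \<in> W}"
      by (simp add: openT op_def top)
  qed (simp add: top)
  ultimately have "group_topology T"
    using top by (simp add: group_topology_def)
  moreover have "\<exists>W. openin T W \<and> 0 \<in> W \<and> W \<subseteq> U" if "U \<in> \<N>" for U
    using core_open[of 0 U] core_mem[OF that, of 0] core_sub[of 0 U] by auto
  moreover have "\<exists>U\<in>\<N>. U \<subseteq> W" if "openin T W" "0 \<in> W" for W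
    using that by (fastforce simp: openT op_def)
  ultimately show ?thesis
    using that by blast
qed

text \<open>\<open>tau\<close> is a \<open>THE\<close>, so a strongest topology must be exhibited
  and shown unique. The witness is the join of all group topologies in which \<open>a\<close> tends
  to 0: continuity is checked on subbasic sets, each of which comes from a single such topology, and
  two strongest topologies have the same open sets.\<close>

lemma tau_properties:
  fixes a :: "nat \<Rightarrow> 'a::ab_group_add"
  assumes "T_sequence a"
  shows "group_topology (tau a)" "limitin (tau a) a 0 sequentially"
    "\<And>T U. \<lbrakk>group_topology T; limitin T a 0 sequentially; openin T U\<rbrakk> \<Longrightarrow> openin (tau a) U"
proof -
  let ?P = "\<lambda>T. group_topology T \<and> limitin T a 0 sequentially"
  let ?Q = "\<lambda>T. group_topology T \<and> limitin T a 0 sequentially \<and>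
      (\<forall>T'. group_topology T' \<and> limitin T' a 0 sequentially \<longrightarrow> (\<forall>U. openin T' U \<longrightarrow> openin T U))"
  define \<S> where "\<S> = {U. \<exists>T. ?P T \<and> openin T U}"
  define S where "S = topology_generated_by \<S>"
  have fine: "openin S U" if "?P T" "openin T U" for T U
    using that unfolding S_def \<S>_def by (intro topology_generated_by_Basis) blast
  have "\<exists>T. ?P T"
    using assms by (auto simp: T_sequence_def)
  then have "UNIV \<in> \<S>"
    unfolding \<S>_def group_topology_def by (metis (mono_tags, lifting) mem_Collect_eq openin_topspace)
  then have top: "topspace S = UNIV"
    using fine openin_subset by (auto simp: S_def topology_generated_by_topspace)
  have "continuous_map (prod_topology S S) S (\<lambda>(x, y). x + y)"
    unfolding S_def
  proof (rule continuous_on_generated_topo, unfold S_def[symmetric])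
    fix U assume "U \<in> \<S>"
    then obtain T where T: "?P T" "openin T U"
      by (auto simp: \<S>_def)
    then have "openin (prod_topology T T) {z \<in> topspace (prod_topology T T). (case z of (x, y) \<Rightarrow> x + y) \<in> U}"
      unfolding group_topology_def by (intro openin_continuous_map_preimage) auto
    moreover have "{z \<in> topspace (prod_topology T T). (case z of (x, y) \<Rightarrow> x + y) \<in> U}
        = (\<lambda>(x, y). x + y) -` U \<inter> topspace (prod_topology S S)"
      using T by (auto simp: top group_topology_def)
    ultimately show "openin (prod_topology S S) ((\<lambda>(x, y). x + y) -` U \<inter> topspace (prod_topology S S))"
      using fine[OF T(1)] unfolding openin_prod_topology_alt by metis
  qed (use \<open>UNIV \<in> \<S>\<close> in auto)
  moreover have "continuous_map S S uminus"
    unfolding S_def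
  proof (rule continuous_on_generated_topo, unfold S_def[symmetric])
    fix U assume "U \<in> \<S>"
    then obtain T where T: "?P T" "openin T U"
      by (auto simp: \<S>_def)
    then have "openin T {x \<in> topspace T. - x \<in> U}"
      unfolding group_topology_def by (intro openin_continuous_map_preimage) auto
    then show "openin S (uminus -` U \<inter> topspace S)"
      using T fine[OF T(1)] by (simp add: top group_topology_def vimage_def)
  qed (use \<open>UNIV \<in> \<S>\<close> in auto)
  ultimately have "group_topology S"
    using top by (simp add: group_topology_def)
  moreover have "limitin S a 0 sequentially"
    unfolding limitin_def
  proof (intro conjI allI impI; (elim conjE)?)
    fix U assume "openin S U" "0 \<in> U"
    \<comment> \<open>Convergence passes through finite intersections and unions, so induction on
      the generation of \<open>U\<close> reduces it to sets open in one of the given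
      topologies.\<close>
    then have "generate_topology_on \<S> U"
      by (simp add: S_def openin_topology_generated_by)
    then show "\<forall>\<^sub>F n in sequentially. a n \<in> U"
      using \<open>0 \<in> U\<close>
    proof induction
      case (Int U V)
      then show ?case
        by (auto intro: eventually_conj)
    next
      case (UN K)
      then obtain X where "X \<in> K" "\<forall>\<^sub>F n in sequentially. a n \<in> X"
        by blast
      then show ?case
        by (auto elim: eventually_mono)
    next
      case (Basis U)
      then show ?case
        by (auto simp: \<S>_def dest: limitinD)
    qed simp
  qed (simp add: top)
  ultimately have "?Q S"
    using fine by blast
  moreover have "T = S" if "?Q T" for T
    using that \<open>?Q S\<close> unfolding topology_eq by blast
  ultimately have "?Q (tau a)"
    unfolding tau_def by (rule theI)
  then show "group_topology (tau a)" "limitin (tau a) a 0 sequentially"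
    "\<And>T U. \<lbrakk>group_topology T; limitin T a 0 sequentially; openin T U\<rbrakk> \<Longrightarrow> openin (tau a) U"
    by blast+
qed

section \<open>Algebra of tail sums and word balls\<close>

section \<open>Sums of tails of the sequence\<close>

text \<open>Negatives make each tail symmetric. The element 0 makes sums grow with the number of
  summands, and it is the limit point that makes a tail of a null sequence compact.\<close>

definition tail_set :: "(nat \<Rightarrow> 'a::ab_group_add) \<Rightarrow> nat \<Rightarrow> 'a set" where
  "tail_set a m = insert 0 (a ` {m..} \<union> (\<lambda>n. - a n) ` {m..})"

text \<open>Each summand has its own starting index, so the union over \<open>k\<close> can serve as
  a basic neighbourhood of 0. For \<open>m\<close> constantly 0 these are the balls around 0 of the
  word metric given by the sequence.\<close>

primrec tail_sums :: "(nat \<Rightarrow> 'a::ab_group_add) \<Rightarrow> (nat \<Rightarrow> nat) \<Rightarrow> nat \<Rightarrow> 'a set" where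
  "tail_sums a m 0 = {0}"
| "tail_sums a m (Suc k) = tail_sums a m k + tail_set a (m k)"

abbreviation word_ball :: "(nat \<Rightarrow> 'a::ab_group_add) \<Rightarrow> nat \<Rightarrow> 'a set" where
  "word_ball a \<equiv> tail_sums a (\<lambda>_. 0)"

lemma tail_set_antimono: "m \<le> n \<Longrightarrow> tail_set a n \<subseteq> tail_set a m"
  by (auto simp: tail_set_def)

lemma zero_in_tail_set [simp]: "0 \<in> tail_set a m"
  by (simp add: tail_set_def)

lemma uminus_in_tail_set: "x \<in> tail_set a m \<Longrightarrow> - x \<in> tail_set a m"
  by (auto simp: tail_set_def)

lemma in_tail_set: "m \<le> n \<Longrightarrow> a n \<in> tail_set a m"
  by (auto simp: tail_set_def)

lemma tail_sums_Suc_mono: "tail_sums a m k \<subseteq> tail_sums a m (Suc k)"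
  by (metis add.commute set_zero_plus2 tail_sums.simps(2) zero_in_tail_set)

lemma tail_sums_mono: "k \<le> l \<Longrightarrow> tail_sums a m k \<subseteq> tail_sums a m l"
  by (rule lift_Suc_mono_le[of "tail_sums a m"]) (rule tail_sums_Suc_mono)

lemma tail_sums_antimono: "(\<And>i. m i \<le> n i) \<Longrightarrow> tail_sums a n k \<subseteq> tail_sums a m k"
  by (induction k) (simp_all add: set_plus_mono2 tail_set_antimono)

lemma zero_in_tail_sums [simp]: "0 \<in> tail_sums a m k"
  using tail_sums_mono[of 0 k a m] by auto

lemma uminus_in_tail_sums: "x \<in> tail_sums a m k \<Longrightarrow> - x \<in> tail_sums a m k"
proof (induction k arbitrary: x)
  case (Suc k)
  then obtain y z where "x = y + z" "y \<in> tail_sums a m k" "z \<in> tail_set a (m k)"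
    by (auto elim: set_plus_elim)
  then show ?case
    using set_plus_intro[OF Suc.IH[of y] uminus_in_tail_set[of z]] by simp
qed simp

text \<open>Regrouping the double sum uses the tail from \<open>n i\<close> twice; the two copies
  fit into the positions \<open>2 * i\<close> and \<open>Suc (2 * i)\<close> of the sum for
  \<open>m\<close>.\<close>

lemma tail_sums_halve:
  assumes "\<And>i. m (2 * i) \<le> n i" "\<And>i. m (Suc (2 * i)) \<le> n i"
  shows "tail_sums a n k + tail_sums a n k \<subseteq> tail_sums a m (2 * k)"
proof (induction k)
  case (Suc k)
  have "tail_sums a n (Suc k) + tail_sums a n (Suc k)
      = (tail_sums a n k + tail_sums a n k) + tail_set a (n k) + tail_set a (n k)"
    by (simp add: ac_simps)
  also have "\<dots> \<subseteq> tail_sums a m (2 * k) + tail_set a (m (2 * k)) + tail_set a (m (Suc (2 * k)))"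
    using Suc assms by (intro set_plus_mono2 tail_set_antimono)
  finally show ?case
    by simp
qed simp

lemma word_ball_add: "x \<in> word_ball a i \<Longrightarrow> y \<in> word_ball a j \<Longrightarrow> x + y \<in> word_ball a (i + j)"
proof (induction j arbitrary: y)
  case (Suc j)
  then obtain u v where "y = u + v" "u \<in> word_ball a j" "v \<in> tail_set a 0"
    by (auto elim: set_plus_elim)
  then show ?case
    using Suc.IH[of u] Suc.prems by (auto simp: set_plus_def add.assoc[symmetric])
qed simp

lemma tail_sums_subset_word_ball: "tail_sums a m k \<subseteq> word_ball a k"
  by (rule tail_sums_antimono) simp

lemma word_balls_cover:
  assumes "generated_subgroup (range a) = UNIV"
  obtains k where "x \<in> word_ball a k"
proof -
  have "add_subgroup (\<Union>k. word_ball a k)"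
    unfolding add_subgroup_def
    by (auto intro: word_ball_add uminus_in_tail_sums exI[of _ 0])
  moreover have "a n \<in> word_ball a (Suc 0)" for n
    using in_tail_set[of 0 n a] by simp
  ultimately have "generated_subgroup (range a) \<subseteq> (\<Union>k. word_ball a k)"
    unfolding generated_subgroup_def by (intro Inter_lower) blast
  then show ?thesis
    using assms that by blast
qed

lemma finite_subset_word_ball:
  assumes "generated_subgroup (range a) = UNIV" "finite F"
  obtains k where "F \<subseteq> word_ball a k"
proof -
  have "\<exists>k. F \<subseteq> word_ball a k"
    using assms(2)
  proof (induction F)
    case (insert x F)
    then obtain k where "F \<subseteq> word_ball a k"
      by blast
    moreover obtain l where "x \<in> word_ball a l"
      using word_balls_cover[OF assms(1)] .
    ultimately show ?case
      using tail_sums_mono[of k "max k l" a "\<lambda>_. 0"] tail_sums_mono[of l "max k l" a "\<lambda>_. 0"]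
      by (intro exI[of _ "max k l"]) auto
  qed simp
  then show ?thesis
    using that by blast
qed

lemma countable_tail_sums: "countable (tail_sums a m k)"
proof (induction k)
  case (Suc k)
  have "countable (tail_set a (m k))"
    by (simp add: tail_set_def)
  with Suc show ?case
    by (simp add: set_plus_image)
qed simp

section \<open>Compactness and precompactness of tail sums, and the neighbourhoods of 0 that they
  form\<close>

lemma compactin_set_plus:
  assumes "group_topology T" "compactin T K" "compactin T L"
  shows "compactin T (K + L)"
proof -
  have "compactin (prod_topology T T) (K \<times> L)"
    using assms by (simp add: compactin_Times)
  then show ?thesis
    using assms(1) unfolding set_plus_image group_topology_def by (blast intro: image_compactin)
qed

lemma compactin_tail_set:
  assumes "group_topology T" "limitin T a 0 sequentially"
  shows "compactin T (tail_set a m)"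
proof -
  have top: "topspace T = UNIV"
    using assms(1) by (simp add: group_topology_def)
  have "compactin T (insert 0 (a ` {m..}))"
    using assms(2) by (rule compactin_sequence_with_limit) (auto simp: top)
  moreover have "compactin T (insert 0 ((\<lambda>n. - a n) ` {m..}))"
    using group_topology_limit_uminus[OF assms]
    by (rule compactin_sequence_with_limit) (auto simp: top)
  ultimately have "compactin T (insert 0 (a ` {m..}) \<union> insert 0 ((\<lambda>n. - a n) ` {m..}))"
    by (rule compactin_Un)
  then show ?thesis
    by (simp add: tail_set_def Un_commute)
qed

text \<open>Applied in a Hausdorff topology witnessing \<open>T_sequence a\<close>, where it makes
  tail sums closed. The precompact counterpart is applied in \<open>tau a\<close>, to produce
  entourages.\<close>

lemma compactin_tail_sums:
  assumes "group_topology T" "limitin T a 0 sequentially"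
  shows "compactin T (tail_sums a m k)"
proof (induction k)
  case 0
  then show ?case
    using assms(1) by (simp add: group_topology_def)
next
  case (Suc k)
  then show ?case
    using assms by (simp add: compactin_set_plus compactin_tail_set)
qed

lemma precompact_set_plus:
  assumes T: "group_topology T" and A: "precompact T A" and B: "precompact T B"
  shows "precompact T (A + B)"
  unfolding precompact_def
proof (intro allI impI, elim conjE)
  fix U assume "openin T U" "0 \<in> U"
  then obtain V where V: "openin T V" "0 \<in> V" "\<And>x y. x \<in> V \<Longrightarrow> y \<in> V \<Longrightarrow> x + y \<in> U"
    using group_topology_add_nhd[OF T] by metis
  obtain F where F: "finite F" "A \<subseteq> (\<Union>x\<in>F. (\<lambda>u. x + u) ` V)"
    using A V unfolding precompact_def by meson
  obtain H where H: "finite H" "B \<subseteq> (\<Union>x\<in>H. (\<lambda>u. x + u) ` V)"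
    using B V unfolding precompact_def by meson
  have "A + B \<subseteq> (\<Union>x\<in>F + H. (\<lambda>u. x + u) ` U)"
  proof
    fix z assume "z \<in> A + B"
    then obtain x y where xy: "z = x + y" "x \<in> A" "y \<in> B"
      by (auto elim: set_plus_elim)
    obtain f u where f: "f \<in> F" "x = f + u" "u \<in> V"
      using F xy by blast
    obtain h v where h: "h \<in> H" "y = h + v" "v \<in> V"
      using H xy by blast
    have "z = (f + h) + (u + v)"
      using xy f h by (simp add: algebra_simps)
    then show "z \<in> (\<Union>x\<in>F + H. (\<lambda>u. x + u) ` U)"
      using f h V(3) by blast
  qed
  then show "\<exists>F. finite F \<and> A + B \<subseteq> (\<Union>x\<in>F. (\<lambda>u. x + u) ` U)"
    using finite_set_plus[OF F(1) H(1)] by blast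
qed

lemma precompact_tail_set:
  assumes "group_topology T" "limitin T a 0 sequentially"
  shows "precompact T (tail_set a m)"
  unfolding precompact_def
proof (intro allI impI, elim conjE)
  fix U assume U: "openin T U" "0 \<in> U"
  have "\<forall>\<^sub>F n in sequentially. a n \<in> U \<and> - a n \<in> U"
    using limitinD[OF assms(2) U] limitinD[OF group_topology_limit_uminus[OF assms] U]
    by (rule eventually_conj)
  then obtain N where N: "\<And>n. n \<ge> N \<Longrightarrow> a n \<in> U \<and> - a n \<in> U"
    by (auto simp: eventually_sequentially)
  let ?F = "insert 0 (a ` {..<N} \<union> (\<lambda>n. - a n) ` {..<N})"
  have "a n \<in> ?F \<union> U" "- a n \<in> ?F \<union> U" for n
    using N[of n] by (cases "n < N"; simp)+
  then have "x \<in> ?F \<or> x \<in> U" if "x \<in> tail_set a m" for x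
    using that unfolding tail_set_def by blast
  then have "tail_set a m \<subseteq> (\<Union>x\<in>?F. (\<lambda>u. x + u) ` U)"
    using U(2) by force
  then show "\<exists>F. finite F \<and> tail_set a m \<subseteq> (\<Union>x\<in>F. (\<lambda>u. x + u) ` U)"
    by (intro exI[of _ ?F]) simp
qed

lemma precompact_tail_sums:
  assumes "group_topology T" "limitin T a 0 sequentially"
  shows "precompact T (tail_sums a m k)"
proof (induction k)
  case 0
  show ?case
    unfolding precompact_def by (auto intro!: exI[of _ "{0}"])
next
  case (Suc k)
  then show ?case
    using assms by (simp add: precompact_set_plus precompact_tail_set)
qed

text \<open>The unions of tail sums, for all \<open>m\<close>, satisfy the neighbourhood axioms. In
  the resulting group topology \<open>a\<close> tends to 0, so \<open>tau a\<close> is finer and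
  inherits its open sets.\<close>

lemma tail_sums_nhd_of_tau:
  fixes a :: "nat \<Rightarrow> 'a::ab_group_add"
  assumes "T_sequence a"
  obtains W where "openin (tau a) W" "0 \<in> W" "W \<subseteq> (\<Union>k. tail_sums a m k)"
proof -
  define \<N> where "\<N> = range (\<lambda>m. \<Union>k. tail_sums a m k)"
  obtain T where T: "group_topology T"
    and N: "\<And>U. U \<in> \<N> \<Longrightarrow> \<exists>W. openin T W \<and> 0 \<in> W \<and> W \<subseteq> U"
    and W: "\<And>W. openin T W \<Longrightarrow> 0 \<in> W \<Longrightarrow> \<exists>U\<in>\<N>. U \<subseteq> W"
  proof (rule group_topology_of_neighbourhood_base[of \<N>])
    show "0 \<in> U" if "U \<in> \<N>" for U
      using that by (auto simp: \<N>_def)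
    show "\<exists>W\<in>\<N>. W \<subseteq> U \<inter> V" if UV: "U \<in> \<N>" "V \<in> \<N>" for U V
    proof -
      obtain m n where mn: "U = (\<Union>k. tail_sums a m k)" "V = (\<Union>k. tail_sums a n k)"
        using UV by (auto simp: \<N>_def)
      have "tail_sums a (\<lambda>i. max (m i) (n i)) k \<subseteq> tail_sums a m k"
        "tail_sums a (\<lambda>i. max (m i) (n i)) k \<subseteq> tail_sums a n k" for k
        by (rule tail_sums_antimono, simp)+
      then show ?thesis
        unfolding mn \<N>_def by (intro bexI[of _ "\<Union>k. tail_sums a (\<lambda>i. max (m i) (n i)) k"]) blast+
    qed
    show "\<exists>V\<in>\<N>. \<forall>x\<in>V. \<forall>y\<in>V. x + y \<in> U" if U: "U \<in> \<N>" for U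
    proof -
      obtain m where m: "U = (\<Union>k. tail_sums a m k)"
        using U by (auto simp: \<N>_def)
      \<comment> \<open>The maximum meets both index conditions of
        \<open>tail_sums_halve\<close>.\<close>
      define n where "n = (\<lambda>i. max (m (2 * i)) (m (Suc (2 * i))))"
      have "x + y \<in> U" if "x \<in> tail_sums a n k" "y \<in> tail_sums a n l" for x y k l
      proof -
        have "x \<in> tail_sums a n (max k l)" "y \<in> tail_sums a n (max k l)"
          using that tail_sums_mono[of k "max k l" a n] tail_sums_mono[of l "max k l" a n] by auto
        then have "x + y \<in> tail_sums a m (2 * max k l)"
          using tail_sums_halve[of m n a "max k l"] unfolding n_def by (meson max.cobounded1 max.cobounded2 set_plus_intro subsetD)
        then show ?thesis
          using m by blast
      qed
      then show ?thesis
        unfolding \<N>_def by (intro bexI[of _ "\<Union>k. tail_sums a n k"]) auto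
    qed
    show "\<exists>V\<in>\<N>. \<forall>x\<in>V. - x \<in> U" if "U \<in> \<N>" for U
      using that by (intro bexI[of _ U]) (auto simp: \<N>_def intro: uminus_in_tail_sums)
  qed (auto simp: \<N>_def)
  have "limitin T a 0 sequentially"
    unfolding limitin_def
  proof (intro conjI allI impI; (elim conjE)?)
    fix V assume "openin T V" "0 \<in> V"
    then obtain m where m: "(\<Union>k. tail_sums a m k) \<subseteq> V"
      using W unfolding \<N>_def by blast
    \<comment> \<open>The first summand alone already contains the tail from
      \<open>m 0\<close>.\<close>
    have "a n \<in> V" if "n \<ge> m 0" for n
    proof -
      have "a n \<in> tail_sums a m (Suc 0)"
        using in_tail_set[OF that, of a] by simp
      then show ?thesis
        using m by blast
    qed
    then show "\<forall>\<^sub>F n in sequentially. a n \<in> V"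
      by (auto simp: eventually_sequentially)
  next
    show "0 \<in> topspace T"
      using T by (simp add: group_topology_def)
  qed
  then show ?thesis
    using N[of "\<Union>k. tail_sums a m k"] tau_properties(3)[OF assms T] that
    by (auto simp: \<N>_def)
qed

text \<open>Every \<open>z\<close> in \<open>R\<close> is a limit of points \<open>z + a n\<close>
  of \<open>R\<close>, infinitely many indices giving points different from \<open>z\<close>. If
  \<open>R\<close> lay in \<open>K\<close>, its closure would be a nonempty perfect subset of a
  countable compact Hausdorff space, whereas such a perfect set has at least the cardinality of the
  reals.\<close>

lemma not_subset_countable_compact:
  fixes a :: "nat \<Rightarrow> 'a::ab_group_add"
  assumes T: "group_topology T" "Hausdorff_space T" "limitin T a 0 sequentially"
    and a: "nontrivial_seq a"
    and R: "0 \<in> R" "\<And>z. z \<in> R \<Longrightarrow> \<forall>\<^sub>F n in sequentially. z + a n \<in> R"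
    and K: "compactin T K" "countable K"
  shows "\<not> R \<subseteq> K"
proof
  assume "R \<subseteq> K"
  have top: "topspace T = UNIV"
    using T by (simp add: group_topology_def)
  define L where "L = T closure_of R"
  have "closedin T K"
    using T K by (simp add: compactin_imp_closedin)
  then have "L \<subseteq> K"
    unfolding L_def using \<open>R \<subseteq> K\<close> by (simp add: closure_of_minimal)
  have "R \<subseteq> T derived_set_of R"
  proof
    fix z assume z: "z \<in> R"
    show "z \<in> T derived_set_of R"
      unfolding derived_set_of_def
    proof (intro CollectI conjI allI impI; (elim conjE)?)
      fix U assume U: "z \<in> U" "openin T U"
      have "limitin T (\<lambda>n. z + a n) z sequentially"
        using continuous_map_limit[OF group_topology_continuous_translation[OF T(1), of z] T(3)]
        by (simp add: comp_def)
      then have "\<forall>\<^sub>F n in sequentially. z + a n \<in> U \<and> z + a n \<in> R"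
        using eventually_conj[OF limitinD[OF _ U(2,1)] R(2)[OF z]] by blast
      moreover have "\<exists>\<^sub>F n in sequentially. a n \<noteq> 0"
        using a unfolding nontrivial_seq_def cofinite_eq_sequentially[symmetric]
        by (simp add: frequently_cofinite)
      ultimately have "\<exists>\<^sub>F n in sequentially. a n \<noteq> 0 \<and> z + a n \<in> U \<and> z + a n \<in> R"
        using frequently_eventually_frequently by blast
      then obtain n where "a n \<noteq> 0" "z + a n \<in> U" "z + a n \<in> R"
        using frequently_ex by blast
      then show "\<exists>y. y \<noteq> z \<and> y \<in> R \<and> y \<in> U"
        by (intro exI[of _ "z + a n"]) simp
    qed (simp add: top)
  qed
  then have "T derived_set_of R = L"
    using top by (auto simp: L_def closure_of)
  moreover have "R \<subseteq> L" "closedin T L"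
    using top by (simp_all add: L_def closure_of_subset)
  ultimately have "T derived_set_of L = L"
    using derived_set_of_mono[of R L T] closedin_contains_derived_set[of T L] by blast
  \<comment> \<open>The cardinality theorem asks for local compactness, which is available inside
    \<open>K\<close>.\<close>
  then have "subtopology T K derived_set_of L = L"
    using \<open>L \<subseteq> K\<close> by (simp add: derived_set_of_subtopology inf.absorb2)
  moreover have "L \<noteq> {}"
    using R(1) top closure_of_subset[of R T] by (auto simp: L_def)
  moreover have "locally_compact_space (subtopology T K)"
    using K(1) by (simp add: compact_imp_locally_compact_space compact_space_subtopology)
  ultimately have "(UNIV :: real set) \<lesssim> L"
    using T(2) by (intro lepoll_perfect_set[of "subtopology T K"]) (simp_all add: Hausdorff_space_subtopology)
  moreover have "countable L"
    using \<open>L \<subseteq> K\<close> K(2) countable_subset by blast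
  ultimately have "countable (UNIV :: real set)"
    using countable_lepoll by blast
  then show False
    using uncountable_UNIV_real by simp
qed

section \<open>Bounded sets of \<open>tau a\<close> as subsets of word balls\<close>

section \<open>Bounded sets\<close>

text \<open>The indices are chosen one at a time. When the summand number \<open>k\<close> is added,
  the new sum stays in the ball of radius \<open>Suc k\<close> and so misses \<open>D n\<close> for
  all \<open>n > k\<close>; only the finitely many points in \<open>D n\<close> with
  \<open>n\<close> at most \<open>k\<close> restrict the next index.\<close>

lemma exists_tail_sums_avoiding:
  assumes T: "group_topology T" "Hausdorff_space T" "limitin T a 0 sequentially"
    and D: "\<And>n. finite (D n)" "\<And>n. D n \<inter> word_ball a n = {}"
  shows "\<exists>m. \<forall>n k. D n \<inter> tail_sums a m k = {}"
proof -
  \<comment> \<open>Invariant of the construction: compactness yields closedness, and the bound by a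
    ball takes care of the sets \<open>D n\<close> with large \<open>n\<close>.\<close>
  let ?P = "\<lambda>k K. compactin T K \<and> K \<subseteq> word_ball a k \<and> (\<forall>n. D n \<inter> K = {})"
  let ?Q = "\<lambda>k K K'. \<exists>m. K' = K + tail_set a m"
  have base: "\<exists>K. K = {0} \<and> ?P 0 K"
    using compactin_tail_sums[OF T(1,3), of "\<lambda>_. 0" 0] D(2) zero_in_tail_sums
    by (metis disjoint_iff singletonD tail_sums.simps(1) order_refl)
  have step: "\<exists>K'. ?P (Suc k) K' \<and> ?Q k K K'" if K: "?P k K" for k K
  proof -
    have "closedin T K"
      using K T(2) by (simp add: compactin_imp_closedin)
    \<comment> \<open>If \<open>c = x + y\<close> with \<open>x\<close> in \<open>K\<close> and
      \<open>y\<close> in a tail, then \<open>x\<close> is one of \<open>c - a i\<close>,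
      \<open>c + a i\<close> and \<open>c\<close>.\<close>
    have "\<forall>\<^sub>F i in sequentially. c - a i \<notin> K \<and> c + a i \<notin> K \<and> c \<notin> K" if "c \<in> D n" for n c
    proof -
      have "c \<notin> K"
        using K that by blast
      then show ?thesis
        using eventually_translate_notin_closed[OF T(1) T(3) \<open>closedin T K\<close>]
          eventually_translate_notin_closed[OF T(1) group_topology_limit_uminus[OF T(1,3)] \<open>closedin T K\<close>]
        by (auto intro: eventually_conj)
    qed
    then have "\<forall>\<^sub>F i in sequentially. \<forall>c\<in>\<Union> (D ` {..k}). c - a i \<notin> K \<and> c + a i \<notin> K \<and> c \<notin> K"
      using D(1) by (intro eventually_ball_finite) auto
    then obtain m where m: "\<And>i c n. i \<ge> m \<Longrightarrow> n \<le> k \<Longrightarrow> c \<in> D n \<Longrightarrow> c - a i \<notin> K \<and> c + a i \<notin> K \<and> c \<notin> K"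
      unfolding eventually_sequentially by auto
    have sub: "K + tail_set a m \<subseteq> word_ball a (Suc k)"
      using K tail_set_antimono[of 0 m a] by (auto intro: set_plus_mono2[THEN subsetD])
    have "c \<notin> K + tail_set a m" if c: "c \<in> D n" for c n
    proof (cases "n \<le> k")
      case True
      show ?thesis
      proof
        assume "c \<in> K + tail_set a m"
        then obtain x y where xy: "c = x + y" "x \<in> K" "y \<in> tail_set a m"
          by (auto elim: set_plus_elim)
        from xy(3) consider "y = 0" | i where "i \<ge> m" "y = a i" | i where "i \<ge> m" "y = - a i"
          by (auto simp: tail_set_def)
        then show False
        proof cases
          case 1
          then show False
            using m[OF order_refl True c] xy by simp
        next
          case (2 i)
          then show False
            using m[OF 2(1) True c] xy by simp
        next
          case (3 i)
          then show False
            using m[OF 3(1) True c] xy by simp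
        qed
      qed
    next
      case False
      then have "word_ball a (Suc k) \<subseteq> word_ball a n"
        by (intro tail_sums_mono) simp
      then show ?thesis
        using D(2)[of n] c sub by blast
    qed
    moreover have "compactin T (K + tail_set a m)"
      using K T by (simp add: compactin_set_plus compactin_tail_set)
    ultimately have "?P (Suc k) (K + tail_set a m)"
      using sub by blast
    then show ?thesis
      by blast
  qed
  \<comment> \<open>The clause for \<open>k = 0\<close> pins down the first set, which dependent
    choice would otherwise leave arbitrary.\<close>
  have "\<exists>K. \<forall>k. ((k = 0 \<longrightarrow> K k = {0}) \<and> ?P k (K k)) \<and> ?Q k (K k) (K (Suc k))"
  proof (rule dependent_nat_choice)
    show "\<exists>K. (0 = (0::nat) \<longrightarrow> K = {0}) \<and> ?P 0 K"
      using base by blast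
    show "\<exists>K'. ((Suc k = 0 \<longrightarrow> K' = {0}) \<and> ?P (Suc k) K') \<and> ?Q k K K'"
      if "(k = 0 \<longrightarrow> K = {0}) \<and> ?P k K" for K k
      using step[OF conjunct2[OF that]] by simp
  qed
  then obtain K where K: "K 0 = {0}" "\<And>k. ?P k (K k)" "\<And>k. ?Q k (K k) (K (Suc k))"
    by metis
  then obtain m where m: "\<And>k. K (Suc k) = K k + tail_set a (m k)"
    by metis
  have "tail_sums a m k = K k" for k
    by (induction k) (simp_all add: K(1) m)
  then show ?thesis
    using K(2) by (intro exI[of _ m]) simp
qed

lemma precompact_tau_subset_word_ball:
  fixes a :: "nat \<Rightarrow> 'a::ab_group_add"
  assumes a: "T_sequence a" and gen: "generated_subgroup (range a) = UNIV"
    and P: "precompact (tau a) P"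
  obtains k where "P \<subseteq> word_ball a k"
proof (rule ccontr)
  assume "\<not> thesis"
  then have unbounded: "\<not> P \<subseteq> word_ball a k" for k
    using that by blast
  obtain T where T: "group_topology T" "Hausdorff_space T" "limitin T a 0 sequentially"
    using a by (auto simp: T_sequence_def)
  have "UNIV = (\<Union>k. word_ball a k)"
    using word_balls_cover[OF gen] by (metis UNIV_eq_I UN_I UNIV_I)
  then have "countable (UNIV :: 'a set)"
    using countable_tail_sums by (metis countable_UN countableI_type)
  then obtain g :: "nat \<Rightarrow> 'a" where g: "range g = UNIV"
    using range_from_nat_into[of "UNIV :: 'a set"] by blast
  \<comment> \<open>With the first \<open>n\<close> elements of the enumeration in the ball of
    radius \<open>l\<close>, any point outside the ball of radius \<open>n + l\<close> differs from
    each of them by more than \<open>n\<close> letters.\<close>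
  have "\<exists>p\<in>P. \<forall>j<n. p - g j \<notin> word_ball a n" for n
  proof -
    obtain l where l: "g ` {..<n} \<subseteq> word_ball a l"
      using finite_subset_word_ball[OF gen, of "g ` {..<n}"] by auto
    obtain p where p: "p \<in> P" "p \<notin> word_ball a (n + l)"
      using unbounded by blast
    have "p - g j \<notin> word_ball a n" if "j < n" for j
      using word_ball_add[of "p - g j" a n "g j" l] l p that by auto
    then show ?thesis
      using p by blast
  qed
  then obtain p where p: "\<And>n. p n \<in> P" "\<And>n j. j < n \<Longrightarrow> p n - g j \<notin> word_ball a n"
    by metis
  have "\<exists>m. \<forall>n k. (\<lambda>j. p n - g j) ` {..<n} \<inter> tail_sums a m k = {}"
    using p(2) by (intro exists_tail_sums_avoiding[OF T]) auto
  then obtain m where m: "\<And>n k. (\<lambda>j. p n - g j) ` {..<n} \<inter> tail_sums a m k = {}"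
    by blast
  obtain W where W: "openin (tau a) W" "0 \<in> W" "W \<subseteq> (\<Union>k. tail_sums a m k)"
    using tail_sums_nhd_of_tau[OF a] .
  obtain F where F: "finite F" "P \<subseteq> (\<Union>x\<in>F. (\<lambda>u. x + u) ` W)"
    using P W unfolding precompact_def by meson
  have "F \<subseteq> range g"
    using g by simp
  then obtain J where J: "finite J" "F = g ` J"
    using F(1) finite_subset_image by metis
  \<comment> \<open>Once \<open>n\<close> exceeds every index of a centre, the point
    \<open>p n\<close> has been kept out of all the translates at once.\<close>
  then obtain n where n: "\<And>j. j \<in> J \<Longrightarrow> j < n"
    using finite_nat_set_iff_bounded by auto
  obtain j u where "j \<in> J" "u \<in> W" "p n = g j + u"
    using p(1)[of n] F(2) J by blast
  moreover from this obtain k where "u \<in> tail_sums a m k"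
    using W(3) by blast
  ultimately have "p n - g j \<in> tail_sums a m k" "j < n"
    using n by simp_all
  then show False
    using m[of n k] by blast
qed

lemma coarse_bounded_tau_iff:
  fixes a :: "nat \<Rightarrow> 'a::ab_group_add"
  assumes a: "T_sequence a" and gen: "generated_subgroup (range a) = UNIV"
  shows "coarse_bounded (tau a) B \<longleftrightarrow> (\<exists>k. B \<subseteq> word_ball a k)"
proof
  assume "coarse_bounded (tau a) B"
  then obtain P E x where P: "precompact (tau a) P" "E \<subseteq> {(x, y). x \<in> (\<lambda>u. u + y) ` P}"
    "B \<subseteq> ball_of E x"
    unfolding coarse_bounded_def coarse_entourages_def by blast
  obtain k where k: "P \<subseteq> word_ball a k"
    using precompact_tau_subset_word_ball[OF a gen P(1)] .
  obtain l where l: "x \<in> word_ball a l"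
    using word_balls_cover[OF gen] .
  have "y \<in> word_ball a (l + k)" if y: "y \<in> B" for y
  proof -
    obtain u where "u \<in> P" "x = u + y"
      using P(2,3) y unfolding ball_of_def by blast
    then show ?thesis
      using word_ball_add[OF l uminus_in_tail_sums[of u a "\<lambda>_. 0" k]] k by auto
  qed
  then show "\<exists>k. B \<subseteq> word_ball a k"
    by blast
next
  assume "\<exists>k. B \<subseteq> word_ball a k"
  then obtain k where k: "B \<subseteq> word_ball a k"
    by blast
  let ?E = "{(x, y). x \<in> (\<lambda>u. u + y) ` word_ball a k}"
  have "?E \<in> coarse_entourages (tau a)"
    using precompact_tail_sums[OF tau_properties(1,2)[OF a]] unfolding coarse_entourages_def by blast
  \<comment> \<open>The ball of \<open>?E\<close> around 0 consists of the negatives of the word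
    ball, hence equals it by symmetry.\<close>
  moreover have "B \<subseteq> ball_of ?E 0"
    using k by (force simp: ball_of_def image_iff intro: bexI[OF _ uminus_in_tail_sums])
  ultimately show "coarse_bounded (tau a) B"
    unfolding coarse_bounded_def by blast
qed

section \<open>Eventual constancy of slowly oscillating functions, and the quotient\<close>

section \<open>Slowly oscillating functions and ends\<close>

text \<open>The full tail is precompact and defines an entourage. By symmetry its ball around
  \<open>x\<close> contains \<open>x\<close> and all \<open>x + s\<close>, and the exceptional
  bounded set lies in a word ball.\<close>

lemma slowly_oscillating_tau_eventually_invariant:
  fixes a :: "nat \<Rightarrow> 'a::ab_group_add"
  assumes a: "T_sequence a" and gen: "generated_subgroup (range a) = UNIV"
    and f: "slowly_oscillating (tau a) f"
  obtains k where "\<And>x s. x \<notin> word_ball a k \<Longrightarrow> s \<in> tail_set a 0 \<Longrightarrow> f (x + s) = f x"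
proof -
  let ?E = "{(x, y). x \<in> (\<lambda>u. u + y) ` tail_set a 0}"
  have "?E \<in> coarse_entourages (tau a)"
    using precompact_tail_set[OF tau_properties(1,2)[OF a]] unfolding coarse_entourages_def by blast
  then obtain B where B: "coarse_bounded (tau a) B"
      "\<And>x y z. x \<notin> B \<Longrightarrow> y \<in> ball_of ?E x \<Longrightarrow> z \<in> ball_of ?E x \<Longrightarrow> f y = f z"
    using f unfolding slowly_oscillating_def by meson
  obtain k where k: "B \<subseteq> word_ball a k"
    using B(1) coarse_bounded_tau_iff[OF a gen] by blast
  have ball: "x + s \<in> ball_of ?E x" if "s \<in> tail_set a 0" for x s
    using uminus_in_tail_set[OF that] by (force simp: ball_of_def image_iff)
  have "f (x + s) = f x" if x: "x \<notin> word_ball a k" and s: "s \<in> tail_set a 0" for x s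
    using B(2)[OF _ ball[OF s] ball[OF zero_in_tail_set], of x] x k by auto
  then show ?thesis
    using that by blast
qed

lemma slowly_oscillating_tau_eventually_constant:
  fixes a :: "nat \<Rightarrow> 'a::ab_group_add"
  assumes a: "T_sequence a" "nontrivial_seq a" and gen: "generated_subgroup (range a) = UNIV"
    and f: "slowly_oscillating (tau a) f"
  obtains k where "\<And>x y. x \<notin> word_ball a k \<Longrightarrow> y \<notin> word_ball a k \<Longrightarrow> f x = f y"
proof -
  obtain T where T: "group_topology T" "Hausdorff_space T" "limitin T a 0 sequentially"
    using a by (auto simp: T_sequence_def)
  obtain k where k: "\<And>x s. x \<notin> word_ball a k \<Longrightarrow> s \<in> tail_set a 0 \<Longrightarrow> f (x + s) = f x"
    using slowly_oscillating_tau_eventually_invariant[OF a(1) gen f] by blast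
  have closed: "closedin T (word_ball a k)"
    using T by (simp add: compactin_imp_closedin compactin_tail_sums)
  have "f x = f y" if x: "x \<notin> word_ball a k" and y: "y \<notin> word_ball a k" for x y
  proof -
    \<comment> \<open>Instead of recording walks, \<open>R\<close> keeps what they preserve:
      displacements that leave both points outside the ball and both values of \<open>f\<close>
      unchanged. Adding \<open>a n\<close> for large \<open>n\<close> stays in
      \<open>R\<close>.\<close>
    define R where "R = {z. x + z \<notin> word_ball a k \<and> y + z \<notin> word_ball a k
        \<and> f (x + z) = f x \<and> f (y + z) = f y}"
    obtain i where i: "x \<in> word_ball a i"
      using word_balls_cover[OF gen] .
    obtain r where r: "y - x \<in> word_ball a r"
      using word_balls_cover[OF gen] .
    \<comment> \<open>Here \<open>i\<close> bounds the length of \<open>x\<close> and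
      \<open>r\<close> that of \<open>y - x\<close>. For \<open>z\<close> beyond this radius, a path
      of at most \<open>r\<close> letters starting at \<open>x + z\<close> cannot enter the ball of
      radius \<open>k\<close>.\<close>
    have "\<not> R \<subseteq> word_ball a (k + i + r)"
    proof (rule not_subset_countable_compact[OF T a(2)])
      show "0 \<in> R"
        using x y by (simp add: R_def)
      show "\<forall>\<^sub>F n in sequentially. z + a n \<in> R" if z: "z \<in> R" for z
      proof -
        have "\<forall>\<^sub>F n in sequentially. x + z + a n \<notin> word_ball a k"
          "\<forall>\<^sub>F n in sequentially. y + z + a n \<notin> word_ball a k"
          using z by (auto simp: R_def intro: eventually_translate_notin_closed[OF T(1,3) closed])
        then show ?thesis
        proof eventually_elim
          case (elim n)
          then show ?case
            using z k[of "x + z" "a n"] k[of "y + z" "a n"] in_tail_set[of 0 n a]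
            by (simp add: R_def add.assoc)
        qed
      qed
    qed (use T in \<open>simp_all add: compactin_tail_sums countable_tail_sums\<close>)
    then obtain z where z: "z \<in> R" "z \<notin> word_ball a (k + i + r)"
      by blast
    have "f (x + z + p) = f (x + z)" if "p \<in> word_ball a j" "j \<le> r" for p j
      using that
    proof (induction j arbitrary: p)
      case (Suc j)
      then obtain q s where qs: "p = q + s" "q \<in> word_ball a j" "s \<in> tail_set a 0"
        by (auto elim: set_plus_elim)
      \<comment> \<open>Otherwise \<open>z\<close>, obtained by subtracting \<open>x\<close> and
        \<open>q\<close>, would have length at most \<open>k + i + j\<close>.\<close>
      have "x + z + q \<notin> word_ball a k"
      proof
        assume "x + z + q \<in> word_ball a k"
        then have "(x + z + q) + - x + - q \<in> word_ball a (k + i + j)"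
          using i qs by (intro word_ball_add uminus_in_tail_sums)
        then show False
          using z(2) tail_sums_mono[of "k + i + j" "k + i + r" a "\<lambda>_. 0"] Suc.prems by auto
      qed
      then have "f (x + z + p) = f (x + z + q)"
        using k[of "x + z + q" s] qs by (simp add: add.assoc)
      then show ?case
        using Suc qs by simp
    qed simp
    \<comment> \<open>The displacement \<open>y - x\<close> leads from \<open>x + z\<close> to
      \<open>y + z\<close>.\<close>
    from this[OF r order_refl] have "f (y + z) = f (x + z)"
      by (simp add: algebra_simps)
    moreover have "f (x + z) = f x" "f (y + z) = f y"
      using z(1) by (simp_all add: R_def)
    ultimately show ?thesis
      by metis
  qed
  then show ?thesis
    using that by blast
qed

text \<open>Zorn's lemma gives a maximal filter without small members; it is shown to be an
  ultrafilter. With bounded sets as the small ones, this makes \<open>X_sharp\<close>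
  nonempty.\<close>

lemma exists_ultrafilter_avoiding_ideal:
  fixes small :: "'a set \<Rightarrow> bool"
  assumes "\<not> small UNIV" "small {}" "\<And>A B. small B \<Longrightarrow> A \<subseteq> B \<Longrightarrow> small A"
    "\<And>A B. small A \<Longrightarrow> small B \<Longrightarrow> small (A \<union> B)"
  shows "\<exists>p. is_ultrafilter p \<and> (\<forall>P\<in>p. \<not> small P)"
proof -
  define \<F> where "\<F> = {p. UNIV \<in> p \<and> (\<forall>A B. A \<in> p \<and> A \<subseteq> B \<longrightarrow> B \<in> p)
      \<and> (\<forall>A B. A \<in> p \<and> B \<in> p \<longrightarrow> A \<inter> B \<in> p) \<and> (\<forall>A\<in>p. \<not> small A)}"
  have "{UNIV} \<in> \<F>"
    using assms(1) by (auto simp: \<F>_def)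
  moreover have "\<Union>\<C> \<in> \<F>" if C: "\<C> \<noteq> {}" "subset.chain \<F> \<C>" for \<C>
  proof -
    have sub: "\<C> \<subseteq> \<F>" and lin: "\<And>p q. p \<in> \<C> \<Longrightarrow> q \<in> \<C> \<Longrightarrow> p \<subseteq> q \<or> q \<subseteq> p"
      using C(2) by (auto simp: subset_chain_def)
    have "A \<inter> B \<in> \<Union>\<C>" if AB: "A \<in> \<Union>\<C>" "B \<in> \<Union>\<C>" for A B
    proof -
      obtain p q where pq: "p \<in> \<C>" "q \<in> \<C>" "A \<in> p" "B \<in> q"
        using AB by blast
      then obtain r where "r \<in> \<C>" "A \<in> r" "B \<in> r"
        using lin[of p q] by blast
      moreover from this have "A \<inter> B \<in> r"
        using sub unfolding \<F>_def by blast
      ultimately show ?thesis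
        by blast
    qed
    moreover have "UNIV \<in> \<Union>\<C>"
      using C(1) sub unfolding \<F>_def by blast
    moreover have "B \<in> \<Union>\<C>" if "A \<in> \<Union>\<C>" "A \<subseteq> B" for A B
      using that sub unfolding \<F>_def by blast
    moreover have "\<not> small A" if "A \<in> \<Union>\<C>" for A
      using that sub unfolding \<F>_def by blast
    ultimately show ?thesis
      unfolding \<F>_def by blast
  qed
  ultimately obtain p where p: "p \<in> \<F>" and max: "\<And>q. q \<in> \<F> \<Longrightarrow> p \<subseteq> q \<Longrightarrow> q = p"
    using subset_Zorn_nonempty[of \<F>] by (metis empty_iff)
  have top: "UNIV \<in> p" and up: "\<And>A B. A \<in> p \<Longrightarrow> A \<subseteq> B \<Longrightarrow> B \<in> p"
    and int: "\<And>A B. A \<in> p \<Longrightarrow> B \<in> p \<Longrightarrow> A \<inter> B \<in> p" and big: "\<And>A. A \<in> p \<Longrightarrow> \<not> small A"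
    using p unfolding \<F>_def by blast+
  have small_inter: "\<exists>P\<in>p. small (P \<inter> A)" if A: "A \<notin> p" for A
  proof (rule ccontr)
    assume *: "\<not> (\<exists>P\<in>p. small (P \<inter> A))"
    \<comment> \<open>The filter generated by \<open>p\<close> and \<open>A\<close>, which would
      properly extend \<open>p\<close>.\<close>
    define q where "q = {C. \<exists>P\<in>p. P \<inter> A \<subseteq> C}"
    have "B \<inter> C \<in> q" if BC: "B \<in> q" "C \<in> q" for B C
    proof -
      obtain P Q where PQ: "P \<in> p" "Q \<in> p" "P \<inter> A \<subseteq> B" "Q \<inter> A \<subseteq> C"
        using BC by (auto simp: q_def)
      then show ?thesis
        using int[OF PQ(1,2)] unfolding q_def by (intro CollectI bexI[of _ "P \<inter> Q"]) auto
    qed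
    moreover have "\<not> small B" if "B \<in> q" for B
      using that * assms(3) unfolding q_def by blast
    moreover have "UNIV \<in> q"
      using top unfolding q_def by blast
    moreover have "C \<in> q" if "B \<in> q" "B \<subseteq> C" for B C
      using that unfolding q_def by blast
    ultimately have "q \<in> \<F>"
      unfolding \<F>_def by blast
    moreover have "p \<subseteq> q"
      unfolding q_def by blast
    moreover have "A \<in> q"
      using top unfolding q_def by blast
    ultimately show False
      using max[of q] A by blast
  qed
  have "A \<in> p \<or> - A \<in> p" for A
  proof (rule ccontr)
    assume "\<not> (A \<in> p \<or> - A \<in> p)"
    then obtain P Q where PQ: "P \<in> p" "Q \<in> p" "small (P \<inter> A)" "small (Q \<inter> - A)"
      using small_inter[of A] small_inter[of "- A"] by blast
    \<comment> \<open>Splitting along \<open>A\<close>, this intersection is covered by the two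
      small sets.\<close>
    have "small (P \<inter> Q)"
      by (rule assms(3)[OF assms(4)[OF PQ(3,4)]]) blast
    then show False
      using big[OF int[OF PQ(1,2)]] by blast
  qed
  moreover have "{} \<notin> p"
    using big assms(2) by blast
  ultimately have "is_ultrafilter p"
    using p unfolding is_ultrafilter_def \<F>_def by simp
  then show ?thesis
    using big by blast
qed

lemma beta_ext_eqI:
  assumes "is_ultrafilter p" "{x. f x = i} \<in> p"
  shows "beta_ext f p = i"
  unfolding beta_ext_def
proof (rule the_equality)
  fix j assume "{x. f x = j} \<in> p"
  then have "{x. f x = j} \<inter> {x. f x = i} \<in> p" "{} \<notin> p"
    using assms unfolding is_ultrafilter_def by blast+
  then show "j = i"
    by (metis (mono_tags, lifting) Int_emptyI mem_Collect_eq)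
qed (rule assms)

theorem theorem6:
  fixes a :: "nat \<Rightarrow> 'a::ab_group_add"
  assumes "T_sequence a"
    and "nontrivial_seq a"
    and "generated_subgroup (range a) = UNIV"
  shows "\<exists>c. space_of_ends (tau a) = {c}"
proof -
  note bdd = coarse_bounded_tau_iff[OF assms(1,3)]
  have ext_eq: "beta_ext f p = beta_ext f q"
    if p: "p \<in> X_sharp (tau a)" and q: "q \<in> X_sharp (tau a)" and f: "slowly_oscillating (tau a) f"
    for f p q
  proof -
    obtain k where k: "\<And>x y. x \<notin> word_ball a k \<Longrightarrow> y \<notin> word_ball a k \<Longrightarrow> f x = f y"
      using slowly_oscillating_tau_eventually_constant[OF assms f] by blast
    obtain i where i: "- word_ball a k \<subseteq> {x. f x = i}"
      using k by blast
    have "beta_ext f p = i" if "p \<in> X_sharp (tau a)" for p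
    proof (rule beta_ext_eqI)
      show u: "is_ultrafilter p"
        using that by (simp add: X_sharp_def)
      \<comment> \<open>Word balls are bounded, so each point of \<open>X_sharp\<close> contains
        their complements, where \<open>f\<close> is constant.\<close>
      have "word_ball a k \<notin> p"
        using that bdd by (auto simp: X_sharp_def)
      then have "- word_ball a k \<in> p"
        using u unfolding is_ultrafilter_def by blast
      then show "{x. f x = i} \<in> p"
        using u i unfolding is_ultrafilter_def by blast
    qed
    then show ?thesis
      using p q by simp
  qed
  obtain T where T: "group_topology T" "Hausdorff_space T" "limitin T a 0 sequentially"
    using assms(1) by (auto simp: T_sequence_def)
  \<comment> \<open>The case \<open>R = UNIV\<close> shows that the group is unbounded. Hence
    \<open>X_sharp\<close> is nonempty, and the quotient is not empty but a singleton.\<close>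
  have "\<not> UNIV \<subseteq> word_ball a k" for k
    by (rule not_subset_countable_compact[OF T assms(2)])
      (use T in \<open>simp_all add: compactin_tail_sums countable_tail_sums\<close>)
  then have "\<not> coarse_bounded (tau a) UNIV"
    by (simp add: bdd)
  moreover have "coarse_bounded (tau a) {}"
    by (simp add: bdd)
  moreover have "coarse_bounded (tau a) A" if "coarse_bounded (tau a) B" "A \<subseteq> B" for A B
    using that unfolding bdd by blast
  moreover have "coarse_bounded (tau a) (A \<union> B)"
    if AB: "coarse_bounded (tau a) A" "coarse_bounded (tau a) B" for A B
  proof -
    obtain k l where "A \<subseteq> word_ball a k" "B \<subseteq> word_ball a l"
      using AB unfolding bdd by blast
    then have "A \<union> B \<subseteq> word_ball a (max k l)"
      using tail_sums_mono[of k "max k l" a "\<lambda>_. 0"] tail_sums_mono[of l "max k l" a "\<lambda>_. 0"] by auto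
    then show ?thesis
      unfolding bdd by blast
  qed
  ultimately have "\<exists>p. is_ultrafilter p \<and> (\<forall>P\<in>p. \<not> coarse_bounded (tau a) P)"
    by (rule exists_ultrafilter_avoiding_ideal)
  then obtain p where "is_ultrafilter p" "\<forall>P\<in>p. \<not> coarse_bounded (tau a) P"
    by blast
  then have "p \<in> X_sharp (tau a)"
    by (simp add: X_sharp_def)
  moreover have "ends_rel (tau a) = X_sharp (tau a) \<times> X_sharp (tau a)"
    using ext_eq by (auto simp: ends_rel_def)
  ultimately have "space_of_ends (tau a) = {X_sharp (tau a)}"
    by (auto simp: space_of_ends_def quotient_def)
  then show ?thesis
    by blast
qed

end
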